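(* Let $n\ge 1$, let $F:\{0,1\}^n\to\mathbb{R}$ be an arbitrary function, let $f:[0,1]^n\to\mathbb{R}$ be its multilinear extension, and let $g:[0,1]\to\mathbb{R}$ be a binarity constraint function (as defined in the context). Define the Lagrangian $L(x,y) = f(x)+\sum_{i=1}^n y_i\, g(x_i)$ for $x\in[0,1]^n$, $y\in\mathbb{R}^n$. Then $$\inf_{x\in[0,1]^n}\ \sup_{y\in\mathbb{R}^n} L(x,y) \;=\; \sup_{y\in\mathbb{R}^n}\ \inf_{x\in[0,1]^n} L(x,y).$$
   Context: Multilinear extension: for $F:\{0,1\}^n\to\mathbb{R}$, its multilinear extension is $f(x)=\sum_{\xi\in\{0,1\}^n} P_x(\xi)F(\xi)$ for $x\in[0,1]^n$, where $P_x(\xi)=\prod_{i=1}^n x_i^{\xi_i}(1-x_i)^{1-\xi_i}$ (with $0^0=1$). Binarity constraint function: a function $g:[0,1]\to\mathbb{R}$ such that (i) $g$ is convex and continuous on $[0,1]$ with $g(0)=g(1)=0$; (ii) $g$ is differentiable on $(0,1)$, and $g'(x)=0$ if and only if $x=\tfrac12$; (iii) $g(x)=g(1-x)$ for all $x\in[0,1]$. (In particular $g(x)<0$ on $(0,1)$, so $g(x)=0$ if and only if $x\in\{0,1\}$.) Suprema are taken in $\mathbb{R}\cup\{+\infty\}$ and infima in $\mathbb{R}\cup\{\pm\infty\}$. *)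

theory Defs
  imports "HOL-Analysis.Analysis"
begin

text \<open>The dimension \<open>n \<ge> 1\<close> is \<open>CARD('n)\<close> for a finite index type \<open>'n\<close>.  Functions on
  \<open>{0,1}\<^sup>n\<close>, \<open>[0,1]\<^sup>n\<close> and \<open>[0,1]\<close> are total functions of which only the values on these
  sets are used.\<close>

definition binary_cube :: "(nat ^ 'n::finite) set" where
  "binary_cube = {\<xi>. \<forall>i. \<xi> $ i \<in> {0, 1}}"

definition unit_cube :: "(real ^ 'n::finite) set" where
  "unit_cube = {x. \<forall>i. x $ i \<in> {0..1}}"

text \<open>Binary vectors have natural-number entries so that they can serve as exponents
  (with \<open>0 ^ 0 = 1\<close>); the truncated subtraction \<open>1 - \<xi> $ i\<close> is exact on \<open>binary_cube\<close>.\<close>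

definition bernoulli_weight :: "real ^ 'n::finite \<Rightarrow> nat ^ 'n \<Rightarrow> real" where
  "bernoulli_weight x \<xi> = (\<Prod>i\<in>UNIV. (x $ i) ^ (\<xi> $ i) * (1 - x $ i) ^ (1 - \<xi> $ i))"

definition multilinear_extension :: "(nat ^ 'n::finite \<Rightarrow> real) \<Rightarrow> real ^ 'n \<Rightarrow> real" where
  "multilinear_extension F x = (\<Sum>\<xi>\<in>binary_cube. bernoulli_weight x \<xi> * F \<xi>)"

definition binarity_constraint :: "(real \<Rightarrow> real) \<Rightarrow> bool" where
  "binarity_constraint g \<longleftrightarrow>
     convex_on {0..1} g \<and> continuous_on {0..1} g \<and> g 0 = 0 \<and> g 1 = 0 \<and>
     (\<forall>x\<in>{0<..<1}. g differentiable (at x)) \<and>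
     (\<forall>x\<in>{0<..<1}. deriv g x = 0 \<longleftrightarrow> x = 1/2) \<and>
     (\<forall>x\<in>{0..1}. g x = g (1 - x))"

definition lagrangian ::
  "(nat ^ 'n::finite \<Rightarrow> real) \<Rightarrow> (real \<Rightarrow> real) \<Rightarrow> real ^ 'n \<Rightarrow> real ^ 'n \<Rightarrow> real" where
  "lagrangian F g x y = multilinear_extension F x + (\<Sum>i\<in>UNIV. y $ i * g (x $ i))"

text \<open>\<open>binary_cube\<close> is finite, so the sum defining the multilinear extension is a genuine one.\<close>

lemma finite_binary_cube: "finite (binary_cube :: (nat ^ 'n::finite) set)"
proof -
  have "binary_cube \<subseteq> vec_lambda ` (PiE (UNIV :: 'n set) (\<lambda>_. {0, 1 :: nat}))"
  proof
    fix \<xi> :: "nat ^ 'n"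
    assume "\<xi> \<in> binary_cube"
    then have "vec_nth \<xi> \<in> PiE UNIV (\<lambda>_. {0, 1})"
      by (simp add: binary_cube_def PiE_UNIV_domain)
    then show "\<xi> \<in> vec_lambda ` (PiE UNIV (\<lambda>_. {0, 1}))"
      by (metis image_eqI vec_nth_inverse)
  qed
  moreover have "finite (PiE (UNIV :: 'n set) (\<lambda>_. {0, 1 :: nat}))"
    by (intro finite_PiE) auto
  ultimately show ?thesis
    by (meson finite_imageI finite_subset)
qed

end

theory Submission
  imports Defs
begin

text \<open>The multilinear extension is an average of the values of \<open>F\<close>, so it is bounded below by
  \<open>m = min F\<close>, and \<open>y = 0\<close> already gives dual value at least \<open>m\<close>. At a vertex minimizing \<open>F\<close> all
  the terms \<open>g (x\<^sub>i)\<close> vanish, so the primal value is at most \<open>m\<close>. The rest is weak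
  duality.\<close>

text \<open>Weak duality: for every pair of points, the infimum over \<open>x\<close> lies below
  \<open>h x y\<close>, which lies below the supremum over \<open>y\<close>.\<close>

lemma SUP_INF_le_INF_SUP:
  fixes h :: "'a \<Rightarrow> 'b \<Rightarrow> 'c::complete_lattice"
  shows "(SUP y\<in>B. INF x\<in>A. h x y) \<le> (INF x\<in>A. SUP y\<in>B. h x y)"
  by (intro SUP_least INF_greatest) (meson INF_lower SUP_upper order_trans)

lemma bernoulli_weight_nonneg:
  assumes "x \<in> unit_cube"
  shows "0 \<le> bernoulli_weight x \<xi>"
  using assms by (auto simp: bernoulli_weight_def unit_cube_def intro!: prod_nonneg)

text \<open>Turns sums over binary vectors into sums over a function space, the form in which a
  product of sums expands.\<close>

lemma bij_betw_vec_lambda_binary_cube: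
  "bij_betw vec_lambda (PiE (UNIV :: 'n::finite set) (\<lambda>_. {0, 1})) (binary_cube :: (nat ^ 'n) set)"
  by (rule bij_betw_byWitness[where f' = vec_nth])
    (auto simp: binary_cube_def PiE_UNIV_domain, metis not_gr_zero)

text \<open>Expanding the product of the factors \<open>(1 - x $ i) + x $ i = 1\<close> gives one
  term per binary vector, namely its weight.\<close>

lemma sum_bernoulli_weight: "(\<Sum>\<xi>\<in>binary_cube. bernoulli_weight x \<xi>) = 1"
proof -
  have "(\<Sum>\<xi>\<in>binary_cube. bernoulli_weight x \<xi>) =
      (\<Sum>p\<in>PiE UNIV (\<lambda>_. {0, 1}). bernoulli_weight x (vec_lambda p))"
    by (rule sum.reindex_bij_betw[OF bij_betw_vec_lambda_binary_cube, symmetric])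
  also have "\<dots> = (\<Prod>i\<in>UNIV. \<Sum>k\<in>{0, 1}. (x $ i) ^ k * (1 - x $ i) ^ (1 - k))"
    unfolding bernoulli_weight_def vec_lambda_beta by (rule prod_sum_PiE[symmetric]) auto
  finally show ?thesis by simp
qed

lemma multilinear_extension_ge:
  assumes "x \<in> unit_cube" and "\<And>\<xi>. \<xi> \<in> binary_cube \<Longrightarrow> m \<le> F \<xi>"
  shows "m \<le> multilinear_extension F x"
proof -
  \<comment> \<open>Since the total weight is 1, \<open>m\<close> is its own average and can be
    compared with the average of \<open>F\<close> term by term.\<close>
  have "m = (\<Sum>\<xi>\<in>binary_cube. bernoulli_weight x \<xi> * m)"
    by (simp add: sum_bernoulli_weight flip: sum_distrib_right)
  also have "\<dots> \<le> multilinear_extension F x"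
    unfolding multilinear_extension_def
    by (intro sum_mono mult_left_mono assms(2) bernoulli_weight_nonneg[OF assms(1)])
  finally show ?thesis .
qed

text \<open>At a vertex, with \<open>0 ^ 0 = 1\<close>, each factor is a Kronecker delta in its
  coordinate; one mismatch makes the product vanish.\<close>

lemma bernoulli_weight_vertex:
  fixes \<xi> \<eta> :: "nat ^ 'n::finite"
  assumes "\<xi> \<in> binary_cube" "\<eta> \<in> binary_cube"
  shows "bernoulli_weight (\<chi> i. real (\<eta> $ i)) \<xi> = (if \<xi> = \<eta> then 1 else 0)"
proof -
  have factor: "real (\<eta> $ i) ^ (\<xi> $ i) * (1 - real (\<eta> $ i)) ^ (1 - \<xi> $ i) =
      (if \<xi> $ i = \<eta> $ i then 1 else 0)" for i
  proof -
    have "\<xi> $ i = 0 \<or> \<xi> $ i = 1" "\<eta> $ i = 0 \<or> \<eta> $ i = 1"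
      using assms by (auto simp: binary_cube_def)
    then show ?thesis by auto
  qed
  show ?thesis
    unfolding bernoulli_weight_def vec_lambda_beta factor vec_eq_iff
    by (auto split: if_splits)
qed

lemma multilinear_extension_vertex:
  assumes "\<eta> \<in> binary_cube"
  shows "multilinear_extension F (\<chi> i. real (\<eta> $ i)) = F \<eta>"
proof -
  have "multilinear_extension F (\<chi> i. real (\<eta> $ i)) =
      (\<Sum>\<xi>\<in>binary_cube. if \<xi> = \<eta> then F \<xi> else 0)"
    unfolding multilinear_extension_def
    by (intro sum.cong) (auto simp: bernoulli_weight_vertex[OF _ assms])
  then show ?thesis
    using assms by (simp add: finite_binary_cube)
qed

lemma lagrangian_vertex:
  assumes "binarity_constraint g" "\<eta> \<in> binary_cube"
  shows "lagrangian F g (\<chi> i. real (\<eta> $ i)) y = F \<eta>"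
proof -
  have "g 0 = 0" "g 1 = 0"
    using assms(1) unfolding binarity_constraint_def by blast+
  then have "g (real (\<eta> $ i)) = 0" for i
  proof -
    have "\<eta> $ i = 0 \<or> \<eta> $ i = 1"
      using assms(2) by (auto simp: binary_cube_def)
    then show ?thesis
      using \<open>g 0 = 0\<close> \<open>g 1 = 0\<close> by auto
  qed
  then show ?thesis
    by (simp add: lagrangian_def multilinear_extension_vertex[OF assms(2)])
qed

lemma vertex_in_unit_cube:
  assumes "\<eta> \<in> binary_cube"
  shows "(\<chi> i. real (\<eta> $ i)) \<in> unit_cube"
proof -
  have "\<eta> $ i \<le> 1" for i
    using assms by (auto simp: binary_cube_def dest!: spec[of _ i])
  then show ?thesis by (simp add: unit_cube_def)
qed

lemma binary_cube_nonempty: "binary_cube \<noteq> {}"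
  by (auto simp: binary_cube_def intro!: exI[of _ 0])

theorem theorem3p2:
  fixes F :: "nat ^ 'n::finite \<Rightarrow> real" and g :: "real \<Rightarrow> real"
  assumes "binarity_constraint g"
  shows "(INF x\<in>unit_cube. SUP y\<in>(UNIV :: (real ^ 'n) set). ereal (lagrangian F g x y)) =
         (SUP y\<in>(UNIV :: (real ^ 'n) set). INF x\<in>unit_cube. ereal (lagrangian F g x y))"
proof (rule antisym)
  obtain \<eta> :: "nat ^ 'n" where \<eta>: "\<eta> \<in> binary_cube"
    and min: "\<And>\<xi>. \<xi> \<in> binary_cube \<Longrightarrow> F \<eta> \<le> F \<xi>"
    using ex_is_arg_min_if_finite[OF finite_binary_cube binary_cube_nonempty, of F]
    by (auto simp: is_arg_min_linorder)
  have "(INF x\<in>unit_cube. SUP y\<in>(UNIV :: (real ^ 'n) set). ereal (lagrangian F g x y))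
      \<le> (SUP y\<in>(UNIV :: (real ^ 'n) set). ereal (lagrangian F g (\<chi> i. real (\<eta> $ i)) y))"
    by (intro INF_lower vertex_in_unit_cube \<eta>)
  \<comment> \<open>At a vertex the Lagrangian is constant in \<open>y\<close>, so the supremum is
    that constant.\<close>
  also have "\<dots> = ereal (F \<eta>)"
    by (simp add: lagrangian_vertex[OF assms \<eta>])
  \<comment> \<open>The multiplier 0 removes the penalty, leaving the multilinear extension, which
    is at least the minimum \<open>F \<eta>\<close>.\<close>
  also have "\<dots> \<le> (INF x\<in>unit_cube. ereal (lagrangian F g x 0))"
    by (intro INF_greatest) (simp add: lagrangian_def multilinear_extension_ge min)
  also have "\<dots> \<le> (SUP y\<in>(UNIV :: (real ^ 'n) set). INF x\<in>unit_cube. ereal (lagrangian F g x y))"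
    by (rule SUP_upper) simp
  finally show "(INF x\<in>unit_cube. SUP y\<in>(UNIV :: (real ^ 'n) set). ereal (lagrangian F g x y))
      \<le> (SUP y\<in>(UNIV :: (real ^ 'n) set). INF x\<in>unit_cube. ereal (lagrangian F g x y))" .
qed (rule SUP_INF_le_INF_SUP)

end
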